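(* Let $R$ be a commutative ring with identity element. Let $G(z,w)=\sum_{n=0}^\infty g_n(w)\,z^n$ be a formal power series in indeterminates $z$ and $w=(w_i)_{i\in I}$, with coefficients in $R$, satisfying $G(0,0)=0$ and $(\partial G/\partial z)(0,0)=0$ [i.e., $g_0(0)=0$ and $g_1(0)=0$]. Then the unique formal power series $\varphi(w)$ (with coefficients in $R$) with zero constant term satisfying $\varphi(w)=G(\varphi(w),w)$ is given explicitly by $$\varphi(w)^\ell=\sum_{k_0,k_1,k_2,\ldots\ge0}c_\ell(k_0,k_1,k_2,\ldots)\prod_{n=0}^\infty g_n(w)^{k_n}$$ for all integers $\ell\ge1$, where $$c_\ell(k_0,k_1,k_2,\ldots)=\begin{cases}\ell\;\dfrac{\bigl(\sum_{n=0}^\infty k_n-1\bigr)!}{\prod_{n=0}^\infty k_n!}&\text{if }\sum_{n=0}^\infty(n-1)k_n=-\ell,\\[2mm]0&\text{otherwise.}\end{cases}$$ Its coefficients are given by the finite sums $$[w^\alpha]\varphi(w)=\sum_{m=1}^{2|\alpha|}[\zeta^{m-1}w^\alpha]\Bigl[G(\zeta,w)^m-\zeta\,\frac{\partial G(\zeta,w)}{\partial\zeta}\,G(\zeta,w)^{m-1}\Bigr].$$ More generally, if $H(z,w)$ is any formal power series (in the same indeterminates, with coefficients in $R$), we have $$[w^\alpha]H(\varphi(w),w)=[w^\alpha]H(0,w)+\sum_{m=1}^{2|\alpha|}[\zeta^m w^\alpha]\,H(\zeta,w)\Bigl[G(\zeta,w)^m-\zeta\,\frac{\partial G(\zeta,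w)}{\partial\zeta}\,G(\zeta,w)^{m-1}\Bigr].$$
   Context: $I$ is an arbitrary finite or infinite index set, and each $g_n(w)\in R[[w]]$, the ring of formal power series in the indeterminates $w=(w_i)_{i\in I}$ with coefficients in $R$. Here $\alpha=(\alpha_i)_{i\in I}$ ranges over multi-indices of nonnegative integers with finitely many nonzero entries, $w^\alpha=\prod_i w_i^{\alpha_i}$, and $|\alpha|=\sum_i\alpha_i$. $[w^\alpha]$ and $[\zeta^n w^\alpha]$ denote extraction of the coefficient of the indicated monomial from the whole formal power series written to the right. The sum over $k_0,k_1,k_2,\ldots\ge0$ is over sequences of nonnegative integers with finitely many nonzero entries. The numbers $c_\ell(k_0,k_1,\ldots)$ are integers. Empty sums are zero. *)

theory Defs
  imports "HOL-Library.Poly_Mapping" "HOL-Computational_Algebra.Formal_Power_Series"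
begin

text \<open>
  Formal power series in indeterminates indexed by the type \<open>'i\<close>.  Multi-indices are finitely
  supported functions \<open>'i \<Rightarrow>\<^sub>0 nat\<close>, and a series is an arbitrary assignment of coefficients to
  multi-indices.
\<close>

typedef ('i, 'a) mfps = "UNIV :: (('i \<Rightarrow>\<^sub>0 nat) \<Rightarrow> 'a) set"
  morphisms mfps_coeff Abs_mfps by simp

setup_lifting type_definition_mfps

definition mdeg :: "('i \<Rightarrow>\<^sub>0 nat) \<Rightarrow> nat" where
  "mdeg \<alpha> = (\<Sum>i\<in>Poly_Mapping.keys \<alpha>. Poly_Mapping.lookup \<alpha> i)"

lemma mfps_eqI: "(\<And>\<alpha>. mfps_coeff f \<alpha> = mfps_coeff g \<alpha>) \<Longrightarrow> f = g"
  by transfer auto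

abbreviation splits :: "('i \<Rightarrow>\<^sub>0 nat) \<Rightarrow> (('i \<Rightarrow>\<^sub>0 nat) \<times> ('i \<Rightarrow>\<^sub>0 nat)) set" where
  "splits \<alpha> \<equiv> {p. fst p + snd p = \<alpha>}"

lemma finite_splits:
  fixes \<alpha> :: "'i \<Rightarrow>\<^sub>0 nat"
  shows "finite (splits \<alpha>)"
proof -
  define N where "N = Max (insert 0 (Poly_Mapping.lookup \<alpha> ` Poly_Mapping.keys \<alpha>))"
  let ?F = "{f :: 'i \<Rightarrow> nat. \<forall>x. (x \<in> Poly_Mapping.keys \<alpha> \<longrightarrow> f x \<in> {..N}) \<and> (x \<notin> Poly_Mapping.keys \<alpha> \<longrightarrow> f x = 0)}"
  have fin: "finite ?F"
    by (rule finite_set_of_finite_funs) auto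
  have bound: "Poly_Mapping.lookup \<beta> \<in> ?F" if "\<And>x. Poly_Mapping.lookup \<beta> x \<le> Poly_Mapping.lookup \<alpha> x" for \<beta>
  proof -
    have "Poly_Mapping.lookup \<beta> x \<le> N" if "x \<in> Poly_Mapping.keys \<alpha>" for x
    proof -
      have "Poly_Mapping.lookup \<alpha> x \<le> N" unfolding N_def using that by (intro Max_ge) auto
      then show ?thesis using \<open>\<And>x. Poly_Mapping.lookup \<beta> x \<le> Poly_Mapping.lookup \<alpha> x\<close>[of x] by simp
    qed
    moreover have "Poly_Mapping.lookup \<beta> x = 0" if "x \<notin> Poly_Mapping.keys \<alpha>" for x
      using \<open>\<And>x. Poly_Mapping.lookup \<beta> x \<le> Poly_Mapping.lookup \<alpha> x\<close>[of x] that by (simp add: in_keys_iff)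
    ultimately show ?thesis by auto
  qed
  let ?B = "{\<beta>. Poly_Mapping.lookup \<beta> \<in> ?F}"
  have "inj (Poly_Mapping.lookup :: ('i \<Rightarrow>\<^sub>0 nat) \<Rightarrow> _)"
    by (simp add: inj_on_def)
  from finite_vimageI[OF fin this] have "finite ?B"
    by (simp add: vimage_def)
  moreover have "splits \<alpha> \<subseteq> ?B \<times> ?B"
  proof
    fix p assume "p \<in> splits \<alpha>"
    then have "Poly_Mapping.lookup \<alpha> x = Poly_Mapping.lookup (fst p) x + Poly_Mapping.lookup (snd p) x" for x
      by (metis (mono_tags, lifting) lookup_add mem_Collect_eq)
    then have "Poly_Mapping.lookup (fst p) \<in> ?F" "Poly_Mapping.lookup (snd p) \<in> ?F"
      by (intro bound; simp)+
    then show "p \<in> ?B \<times> ?B" by (simp add: mem_Times_iff)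
  qed
  ultimately show ?thesis by (meson finite_SigmaI finite_subset)
qed

instantiation mfps :: (type, comm_ring_1) comm_ring_1
begin

lift_definition zero_mfps :: "('a, 'b) mfps" is "\<lambda>_. 0" .
lift_definition one_mfps :: "('a, 'b) mfps" is "\<lambda>\<alpha>. if \<alpha> = 0 then 1 else 0" .
lift_definition plus_mfps :: "('a, 'b) mfps \<Rightarrow> ('a, 'b) mfps \<Rightarrow> ('a, 'b) mfps"
  is "\<lambda>f g \<alpha>. f \<alpha> + g \<alpha>" .
lift_definition minus_mfps :: "('a, 'b) mfps \<Rightarrow> ('a, 'b) mfps \<Rightarrow> ('a, 'b) mfps"
  is "\<lambda>f g \<alpha>. f \<alpha> - g \<alpha>" .
lift_definition uminus_mfps :: "('a, 'b) mfps \<Rightarrow> ('a, 'b) mfps"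
  is "\<lambda>f \<alpha>. - f \<alpha>" .
lift_definition times_mfps :: "('a, 'b) mfps \<Rightarrow> ('a, 'b) mfps \<Rightarrow> ('a, 'b) mfps"
  is "\<lambda>f g \<alpha>. \<Sum>(\<beta>, \<gamma>)\<in>splits \<alpha>. f \<beta> * g \<gamma>" .

instance
proof
  fix a b c :: "('a, 'b) mfps"
  show "a + b + c = a + (b + c)" "a + b = b + a" "0 + a = a" "- a + a = 0" "a - b = a + - b"
    by (transfer; auto simp: add_ac)+
  show "(0 :: ('a, 'b) mfps) \<noteq> 1"
    by transfer (metis zero_neq_one)
  show "a * b = b * a"
  proof (transfer, rule ext)
    fix a b :: "('a \<Rightarrow>\<^sub>0 nat) \<Rightarrow> 'b" and \<alpha>
    show "(\<Sum>(\<beta>, \<gamma>)\<in>splits \<alpha>. a \<beta> * b \<gamma>) = (\<Sum>(\<beta>, \<gamma>)\<in>splits \<alpha>. b \<beta> * a \<gamma>)"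
      by (rule sum.reindex_bij_witness[of _ prod.swap prod.swap]) (auto simp: ac_simps)
  qed
  show "1 * a = a"
  proof (transfer, rule ext)
    fix a :: "('a \<Rightarrow>\<^sub>0 nat) \<Rightarrow> 'b" and \<alpha>
    have "(\<Sum>(\<beta>, \<gamma>)\<in>splits \<alpha>. (if \<beta> = 0 then 1 else 0) * a \<gamma>) =
          (\<Sum>(\<beta>, \<gamma>)\<in>{(0 :: 'a \<Rightarrow>\<^sub>0 nat, \<alpha>)}. (if \<beta> = 0 then 1 else 0) * a \<gamma>)"
      by (rule sum.mono_neutral_right) (use finite_splits in \<open>auto split: if_splits\<close>)
    then show "(\<Sum>(\<beta>, \<gamma>)\<in>splits \<alpha>. (if \<beta> = 0 then 1 else 0) * a \<gamma>) = a \<alpha>" by simp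
  qed
  show "(a + b) * c = a * c + b * c"
    by transfer (auto simp: distrib_right case_prod_beta sum.distrib)
  show "a * b * c = a * (b * c)"
  proof (transfer, rule ext)
    fix a b c :: "('a \<Rightarrow>\<^sub>0 nat) \<Rightarrow> 'b" and \<alpha>
    have "(\<Sum>(\<beta>, \<gamma>)\<in>splits \<alpha>. (\<Sum>(\<delta>, \<epsilon>)\<in>splits \<beta>. a \<delta> * b \<epsilon>) * c \<gamma>) =
          (\<Sum>p\<in>splits \<alpha>. \<Sum>q\<in>splits (fst p). a (fst q) * b (snd q) * c (snd p))"
      by (simp add: case_prod_beta sum_distrib_right)
    also have "\<dots> = (\<Sum>(p, q)\<in>(SIGMA p:splits \<alpha>. splits (fst p)).
                      a (fst q) * b (snd q) * c (snd p))"
      by (rule sum.Sigma) (auto simp: finite_splits)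
    also have "\<dots> = (\<Sum>(p, q)\<in>(SIGMA p:splits \<alpha>. splits (snd p)).
                      a (fst p) * b (fst q) * c (snd q))"
      by (rule sum.reindex_bij_witness
            [of _ "\<lambda>(p, q). ((fst p + fst q, snd q), (fst p, fst q))"
                  "\<lambda>(p, q). ((fst q, snd q + snd p), (snd q, snd p))"])
         (auto simp: add.assoc)
    also have "\<dots> = (\<Sum>p\<in>splits \<alpha>. \<Sum>q\<in>splits (snd p). a (fst p) * b (fst q) * c (snd q))"
      by (rule sum.Sigma[symmetric]) (auto simp: finite_splits)
    also have "\<dots> = (\<Sum>(\<beta>, \<gamma>)\<in>splits \<alpha>. a \<beta> * (\<Sum>(\<delta>, \<epsilon>)\<in>splits \<gamma>. b \<delta> * c \<epsilon>))"
      by (simp add: case_prod_beta sum_distrib_left mult.assoc)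
    finally show "(\<Sum>(\<beta>, \<gamma>)\<in>splits \<alpha>. (\<Sum>(\<delta>, \<epsilon>)\<in>splits \<beta>. a \<delta> * b \<epsilon>) * c \<gamma>) =
          (\<Sum>(\<beta>, \<gamma>)\<in>splits \<alpha>. a \<beta> * (\<Sum>(\<delta>, \<epsilon>)\<in>splits \<gamma>. b \<delta> * c \<epsilon>))" .
  qed
qed

end

text \<open>
  The subring of power series in \<open>w = (w\<^sub>i)\<close> with \<open>i \<in> I\<close>.  The index set is an explicit set, not
  just the type \<open>'i\<close>, so that it may also be empty.
\<close>

definition mfps_over :: "'i set \<Rightarrow> ('i, 'a::zero) mfps set" where
  "mfps_over I = {f. \<forall>\<alpha>. \<not> Poly_Mapping.keys \<alpha> \<subseteq> I \<longrightarrow> mfps_coeff f \<alpha> = 0}"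

text \<open>
  Infinite sums of power series, taken coefficientwise.  A family is summable when each
  multi-index receives only finitely many nonzero contributions; \<open>formal_sum\<close> has its intended
  meaning only for summable families.
\<close>

definition formal_summable :: "('k \<Rightarrow> ('i, 'a::comm_ring_1) mfps) \<Rightarrow> bool" where
  "formal_summable f \<longleftrightarrow> (\<forall>\<alpha>. finite {k. mfps_coeff (f k) \<alpha> \<noteq> 0})"

definition formal_sum :: "('k \<Rightarrow> ('i, 'a::comm_ring_1) mfps) \<Rightarrow> ('i, 'a) mfps" where
  "formal_sum f = Abs_mfps (\<lambda>\<alpha>. \<Sum>k | mfps_coeff (f k) \<alpha> \<noteq> 0. mfps_coeff (f k) \<alpha>)"

text \<open>
  A series \<open>F(z, w)\<close> is an element of \<open>R[[w]][[z]]\<close>, that is, of type \<open>('i, 'a) mfps fps\<close>.  The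
  series \<open>F(\<phi>(w), w)\<close> is the sum of \<open>f\<^sub>n(w) \<phi>(w)\<^sup>n\<close>; by \<open>summable_subst_z\<close> below it converges
  whenever \<open>\<phi>\<close> has zero constant term.
\<close>

definition subst_z :: "('i, 'a::comm_ring_1) mfps fps \<Rightarrow> ('i, 'a) mfps \<Rightarrow> ('i, 'a) mfps" where
  "subst_z F \<phi> = formal_sum (\<lambda>n. fps_nth F n * \<phi> ^ n)"

definition coeff_zw :: "nat \<Rightarrow> ('i \<Rightarrow>\<^sub>0 nat) \<Rightarrow> ('i, 'a) mfps fps \<Rightarrow> 'a" where
  "coeff_zw n \<alpha> F = mfps_coeff (fps_nth F n) \<alpha>"

text \<open>
  The numbers \<open>c\<^sub>\<ell>(k\<^sub>0, k\<^sub>1, \<dots>)\<close>, with the quotient taken in the rationals so that no rounding is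
  involved.  In the first case, for \<open>\<ell> \<ge> 1\<close>, the sum of all \<open>k\<^sub>n\<close> is positive, so the subtraction of
  1 on natural numbers is not truncated.
\<close>

definition lagrange_c :: "nat \<Rightarrow> (nat \<Rightarrow>\<^sub>0 nat) \<Rightarrow> rat" where
  "lagrange_c l k =
     (if (\<Sum>n\<in>Poly_Mapping.keys k. (int n - 1) * int (Poly_Mapping.lookup k n)) = - int l
      then of_nat l * (fact ((\<Sum>n\<in>Poly_Mapping.keys k. Poly_Mapping.lookup k n) - 1) /
                         (\<Prod>n\<in>Poly_Mapping.keys k. fact (Poly_Mapping.lookup k n)))
      else 0)"

text \<open>The floor is exact: for \<open>l \<ge> 1\<close> the numbers \<open>lagrange_c l k\<close> are integers.\<close>

definition lagrange_term ::
  "(nat \<Rightarrow> ('i, 'a::comm_ring_1) mfps) \<Rightarrow> nat \<Rightarrow> (nat \<Rightarrow>\<^sub>0 nat) \<Rightarrow> ('i, 'a) mfps" where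
  "lagrange_term g l k =
     of_int \<lfloor>lagrange_c l k\<rfloor> *
     (\<Prod>n\<in>Poly_Mapping.keys k. g n ^ Poly_Mapping.lookup k n)"

lemma mdeg_add: "mdeg (\<alpha> + \<beta>) = mdeg \<alpha> + mdeg \<beta>"
proof -
  let ?K = "Poly_Mapping.keys \<alpha> \<union> Poly_Mapping.keys \<beta>"
  have ext: "mdeg \<gamma> = (\<Sum>i\<in>?K. Poly_Mapping.lookup \<gamma> i)" if "Poly_Mapping.keys \<gamma> \<subseteq> ?K" for \<gamma>
    unfolding mdeg_def using that
    by (intro sum.mono_neutral_left) (auto simp: in_keys_iff)
  have "Poly_Mapping.keys (\<alpha> + \<beta>) \<subseteq> ?K" by (rule Poly_Mapping.keys_add)
  then show ?thesis
    by (subst (1 2 3) ext) (auto simp: lookup_add sum.distrib)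
qed

lemma mdeg_eq_0_iff: "mdeg \<alpha> = 0 \<longleftrightarrow> \<alpha> = 0"
  by (auto simp: mdeg_def in_keys_iff intro!: poly_mapping_eqI)

lemma coeff_power_eq_0:
  fixes \<phi> :: "('i, 'a::comm_ring_1) mfps"
  assumes "mfps_coeff \<phi> 0 = 0" "mdeg \<alpha> < n"
  shows "mfps_coeff (\<phi> ^ n) \<alpha> = 0"
  using assms(2)
proof (induction n arbitrary: \<alpha>)
  case (Suc n)
  have "mfps_coeff \<phi> (fst p) * mfps_coeff (\<phi> ^ n) (snd p) = 0" if "p \<in> splits \<alpha>" for p
  proof (cases "fst p = 0")
    case False
    then have "mdeg (snd p) < n"
      using that Suc.prems mdeg_add[of "fst p" "snd p"] mdeg_eq_0_iff[of "fst p"] by auto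
    then show ?thesis using Suc.IH by simp
  qed (simp add: assms(1))
  then show ?case
    by (simp add: times_mfps.rep_eq case_prod_beta)
qed simp

lemma summable_subst_z:
  fixes F :: "('i, 'a::comm_ring_1) mfps fps"
  assumes "mfps_coeff \<phi> 0 = 0"
  shows "formal_summable (\<lambda>n. fps_nth F n * \<phi> ^ n)"
  unfolding formal_summable_def
proof
  fix \<alpha>
  have "mfps_coeff (fps_nth F n * \<phi> ^ n) \<alpha> = 0" if "mdeg \<alpha> < n" for n
  proof -
    have "mfps_coeff (\<phi> ^ n) (snd p) = 0" if "p \<in> splits \<alpha>" for p
      using that \<open>mdeg \<alpha> < n\<close> mdeg_add[of "fst p" "snd p"] by (auto intro!: coeff_power_eq_0 assms)
    then show ?thesis by (simp add: times_mfps.rep_eq case_prod_beta)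
  qed
  then have "{n. mfps_coeff (fps_nth F n * \<phi> ^ n) \<alpha> \<noteq> 0} \<subseteq> {..mdeg \<alpha>}"
    using not_le by auto
  then show "finite {n. mfps_coeff (fps_nth F n * \<phi> ^ n) \<alpha> \<noteq> 0}"
    using finite_subset by blast
qed

end

theory Submission
  imports Defs "HOL-Combinatorics.Multiset_Permutations"
begin

text \<open>
  Write \<open>D = z \<partial>G/\<partial>z\<close> and let \<open>L\<close> be the \<open>R[[w]]\<close>-linear functional
  \<open>L(H) = [z\<^sup>0] H + \<Sum>\<^sub>m [z\<^sup>m] H (G\<^sup>m - D G\<^bsup>m-1\<^esup>)\<close>, with \<open>m \<ge> 1\<close>, on series in \<open>z\<close>. The inversion
  formula says that \<open>L\<close> is evaluation at the fixed point \<open>\<phi>\<close>. Three facts give this over any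
  commutative ring, without dividing by integers and without universal coefficients.

  First, \<open>L\<close> vanishes on multiples of \<open>z - G\<close>, because the sum then telescopes
  (\<open>telescoping_coefficients\<close>). Second, \<open>L(1) = 1\<close>, because \<open>[z\<^sup>m] (G\<^sup>m - D G\<^bsup>m-1\<^esup>) = 0\<close>
  (\<open>lagrange_diagonal_coefficient_eq_0\<close>). Third, every \<open>H\<close> has the form \<open>H(\<phi>) + (z - G) K\<close>, as one
  can divide by \<open>z - \<phi>\<close> with remainder \<open>H(\<phi>)\<close> and \<open>z - G\<close> is a unit times \<open>z - \<phi>\<close>
  (\<open>division_by_fixed_point_equation\<close>). Hence \<open>L(H) = H(\<phi>) L(1) + 0 = H(\<phi>)\<close>, which is
  \<open>coeff_subst_fixed_point\<close>. All sums are finite on each coefficient: if \<open>z\<close> has weight 1 and each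
  \<open>w\<^sub>i\<close> weight 2, the hypotheses on \<open>G\<close> say that its terms have weight at least 2, so
  \<open>[z\<^sup>m w\<^sup>\<alpha>] H (G\<^sup>m - D G\<^bsup>m-1\<^esup>)\<close> vanishes unless \<open>2 m \<le> m + 2|\<alpha>|\<close>.

  The series for \<open>\<phi>\<^sup>l\<close> is the case \<open>H = z\<^sup>l\<close>. Expanding \<open>G\<^sup>m - D G\<^bsup>m-1\<^esup> = (G - D) G\<^bsup>m-1\<^esup>\<close> over words
  \<open>n\<^sub>1 \<dots> n\<^sub>m\<close> and collecting words with the same letters, the coefficient of \<open>\<Prod>\<^sub>n g\<^sub>n\<^bsup>k\<^sub>n\<^esup>\<close> is the integer
  \<open>\<Sum>(1 - n\<^sub>1)\<close> over all arrangements of these letters. Cyclic shifts show that \<open>m\<close> times this integer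
  is \<open>\<Sum>\<^sub>i (1 - n\<^sub>i) = l\<close> times the number \<open>m!/\<Prod>\<^sub>n k\<^sub>n!\<close> of arrangements (\<open>size_mult_head_excess\<close>). So it
  equals \<open>c\<^sub>l(k)\<close>, which is therefore an integer, and it is 0 for \<open>l = 0\<close>, which is the second fact above.

  Existence of \<open>\<phi>\<close> follows by iterating \<open>\<phi> \<mapsto> G(\<phi>)\<close>, a contraction for the weight; uniqueness
  follows from the coefficient formula.
\<close>

section \<open>Coefficients, weights and supports\<close>

lemma mfps_coeff_simps [simp]:
  fixes f g :: "('i, 'a::comm_ring_1) mfps"
  shows "mfps_coeff 0 \<alpha> = (0 :: 'a)"
    and "mfps_coeff (f + g) \<alpha> = mfps_coeff f \<alpha> + mfps_coeff g \<alpha>"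
    and "mfps_coeff (f - g) \<alpha> = mfps_coeff f \<alpha> - mfps_coeff g \<alpha>"
    and "mfps_coeff (- f) \<alpha> = - mfps_coeff f \<alpha>"
    and "mfps_coeff (sum F A) \<alpha> = (\<Sum>k\<in>A. mfps_coeff (F k :: ('i, 'a) mfps) \<alpha>)"
proof -
  show plus: "mfps_coeff (f + g) \<alpha> = mfps_coeff f \<alpha> + mfps_coeff g \<alpha>" for f g :: "('i, 'a) mfps"
    by (simp add: plus_mfps.rep_eq)
  show zero: "mfps_coeff 0 \<alpha> = (0 :: 'a)"
    by (simp add: zero_mfps.rep_eq)
  show "mfps_coeff (sum F A) \<alpha> = (\<Sum>k\<in>A. mfps_coeff (F k :: ('i, 'a) mfps) \<alpha>)"
    by (induction A rule: infinite_finite_induct) (simp_all add: plus zero)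
qed (simp_all add: minus_mfps.rep_eq uminus_mfps.rep_eq)

lemma coeff_mult: "mfps_coeff (f * g) \<alpha> = (\<Sum>p\<in>splits \<alpha>. mfps_coeff f (fst p) * mfps_coeff g (snd p))"
  by (simp add: times_mfps.rep_eq case_prod_beta)

text \<open>
  Each \<open>w\<^sub>i\<close> gets weight 2. If \<open>z\<close> gets weight 1, then \<open>g\<^sub>0(0) = g\<^sub>1(0) = 0\<close> means that \<open>G\<close> has no
  term of weight below 2; this is where the bound \<open>2|\<alpha>|\<close> on the summation index comes from.
\<close>

definition weight_ge :: "nat \<Rightarrow> ('i, 'a::comm_ring_1) mfps \<Rightarrow> bool" where
  "weight_ge N f \<longleftrightarrow> (\<forall>\<alpha>. 2 * mdeg \<alpha> < N \<longrightarrow> mfps_coeff f \<alpha> = 0)"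

lemma weight_ge_trivial [simp]: "weight_ge 0 f"
  by (simp add: weight_ge_def)

lemma weight_ge_mono: "weight_ge N f \<Longrightarrow> M \<le> N \<Longrightarrow> weight_ge M f"
  by (simp add: weight_ge_def)

lemma weight_ge_add: "weight_ge N f \<Longrightarrow> weight_ge N g \<Longrightarrow> weight_ge N (f + g)"
  and weight_ge_diff: "weight_ge N f \<Longrightarrow> weight_ge N g \<Longrightarrow> weight_ge N (f - g)"
  and weight_ge_sum: "(\<And>k. k \<in> A \<Longrightarrow> weight_ge N (F k)) \<Longrightarrow> weight_ge N (sum F A)"
  by (auto simp: weight_ge_def)

lemma weight_ge_constant_free:
  fixes f :: "('i, 'a::comm_ring_1) mfps"
  assumes "mfps_coeff f 0 = 0"
  shows "weight_ge 2 f"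
  unfolding weight_ge_def
proof (intro allI impI)
  fix \<alpha> :: "'i \<Rightarrow>\<^sub>0 nat"
  assume "2 * mdeg \<alpha> < 2"
  then have "mdeg \<alpha> = 0" by simp
  then show "mfps_coeff f \<alpha> = 0" using assms by (simp add: mdeg_eq_0_iff)
qed

lemma weight_ge_mult:
  fixes f g :: "('i, 'a::comm_ring_1) mfps"
  assumes "weight_ge M f" "weight_ge N g"
  shows "weight_ge (M + N) (f * g)"
  unfolding weight_ge_def
proof (intro allI impI)
  fix \<alpha> :: "'i \<Rightarrow>\<^sub>0 nat"
  assume \<alpha>: "2 * mdeg \<alpha> < M + N"
  have "mfps_coeff f (fst p) * mfps_coeff g (snd p) = 0" if "p \<in> splits \<alpha>" for p
  proof -
    have "mdeg \<alpha> = mdeg (fst p) + mdeg (snd p)"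
      using that by (simp flip: mdeg_add)
    then have "2 * mdeg (fst p) < M \<or> 2 * mdeg (snd p) < N"
      using \<alpha> by linarith
    then show ?thesis using assms by (auto simp: weight_ge_def)
  qed
  then show "mfps_coeff (f * g) \<alpha> = 0"
    by (simp add: coeff_mult)
qed

lemma weight_ge_power: "weight_ge M f \<Longrightarrow> weight_ge (n * M) (f ^ n)"
  by (induction n) (simp_all add: weight_ge_mult)

text \<open>The variable \<open>z\<close> has weight 1; truncated subtraction leaves high powers of \<open>z\<close> unrestricted.\<close>

definition zweight_ge :: "nat \<Rightarrow> ('i, 'a::comm_ring_1) mfps fps \<Rightarrow> bool" where
  "zweight_ge N F \<longleftrightarrow> (\<forall>n. weight_ge (N - n) (fps_nth F n))"

lemma coeff_eq_0_of_zweight_ge: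
  "zweight_ge N F \<Longrightarrow> n + 2 * mdeg \<alpha> < N \<Longrightarrow> mfps_coeff (fps_nth F n) \<alpha> = 0"
  by (simp add: zweight_ge_def weight_ge_def)

lemma zweight_ge_trivial [simp]: "zweight_ge 0 F"
  by (simp add: zweight_ge_def)

lemma zweight_ge_diff: "zweight_ge N F \<Longrightarrow> zweight_ge N K \<Longrightarrow> zweight_ge N (F - K)"
  by (simp add: zweight_ge_def weight_ge_diff)

lemma zweight_ge_mult:
  assumes "zweight_ge M F" "zweight_ge N K"
  shows "zweight_ge (M + N) (F * K)"
  unfolding zweight_ge_def fps_mult_nth
proof (intro allI weight_ge_sum)
  fix n i :: nat assume "i \<in> {0..n}"
  then have "M + N - n \<le> (M - i) + (N - (n - i))" by auto
  moreover have "weight_ge ((M - i) + (N - (n - i))) (fps_nth F i * fps_nth K (n - i))"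
    using assms by (simp add: zweight_ge_def weight_ge_mult)
  ultimately show "weight_ge (M + N - n) (fps_nth F i * fps_nth K (n - i))"
    by (rule weight_ge_mono[rotated])
qed

lemma zweight_ge_power: "zweight_ge N F \<Longrightarrow> zweight_ge (m * N) (F ^ m)"
  by (induction m) (simp_all add: zweight_ge_mult)

lemma mfps_over_0 [simp]: "0 \<in> mfps_over I"
  and mfps_over_1 [simp]: "1 \<in> mfps_over I"
  and mfps_over_sum: "(\<And>k. k \<in> A \<Longrightarrow> F k \<in> mfps_over I) \<Longrightarrow> sum F A \<in> mfps_over I"
  by (auto simp: mfps_over_def one_mfps.rep_eq)

lemma mfps_over_mult:
  fixes f g :: "('i, 'a::comm_ring_1) mfps"
  assumes "f \<in> mfps_over I" "g \<in> mfps_over I"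
  shows "f * g \<in> mfps_over I"
  unfolding mfps_over_def
proof (intro CollectI allI impI)
  fix \<alpha> :: "'i \<Rightarrow>\<^sub>0 nat"
  assume \<alpha>: "\<not> Poly_Mapping.keys \<alpha> \<subseteq> I"
  have "mfps_coeff f (fst p) * mfps_coeff g (snd p) = 0" if "p \<in> splits \<alpha>" for p
  proof -
    have "Poly_Mapping.keys \<alpha> \<subseteq> Poly_Mapping.keys (fst p) \<union> Poly_Mapping.keys (snd p)"
      using that Poly_Mapping.keys_add[of "fst p" "snd p"] by simp
    then have "\<not> Poly_Mapping.keys (fst p) \<subseteq> I \<or> \<not> Poly_Mapping.keys (snd p) \<subseteq> I"
      using \<alpha> by blast
    then show ?thesis using assms by (auto simp: mfps_over_def)
  qed
  then show "mfps_coeff (f * g) \<alpha> = 0" by (simp add: coeff_mult)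
qed

lemma mfps_over_power: "f \<in> mfps_over I \<Longrightarrow> f ^ n \<in> mfps_over I"
  by (induction n) (simp_all add: mfps_over_mult)

section \<open>Substitution for z\<close>

lemma coeff_formal_sum:
  assumes "finite A" "\<And>k. k \<notin> A \<Longrightarrow> mfps_coeff (f k) \<alpha> = 0"
  shows "mfps_coeff (formal_sum f) \<alpha> = (\<Sum>k\<in>A. mfps_coeff (f k) \<alpha>)"
proof -
  have "mfps_coeff (formal_sum f) \<alpha> = (\<Sum>k | mfps_coeff (f k) \<alpha> \<noteq> 0. mfps_coeff (f k) \<alpha>)"
    by (simp add: formal_sum_def Abs_mfps_inverse)
  also have "\<dots> = (\<Sum>k\<in>A. mfps_coeff (f k) \<alpha>)"
    by (rule sum.mono_neutral_left) (use assms in auto)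
  finally show ?thesis .
qed

lemma coeff_subst_z:
  assumes "mfps_coeff \<phi> 0 = 0" "mdeg \<alpha> \<le> N"
  shows "mfps_coeff (subst_z F \<phi>) \<alpha> = (\<Sum>n\<le>N. mfps_coeff (fps_nth F n * \<phi> ^ n) \<alpha>)"
  unfolding subst_z_def
proof (rule coeff_formal_sum)
  fix n assume "n \<notin> {..N}"
  have "weight_ge (0 + n * 2) (fps_nth F n * \<phi> ^ n)"
    by (intro weight_ge_mult weight_ge_power weight_ge_constant_free assms) simp
  then show "mfps_coeff (fps_nth F n * \<phi> ^ n) \<alpha> = 0"
    using \<open>n \<notin> {..N}\<close> assms(2) by (auto simp: weight_ge_def)
qed simp

lemma coeff_zero_subst_z:
  assumes "mfps_coeff \<phi> 0 = 0"
  shows "mfps_coeff (subst_z F \<phi>) 0 = mfps_coeff (fps_nth F 0) 0"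
  using coeff_subst_z[OF assms, of 0 0] by (simp add: mdeg_eq_0_iff)

lemma subst_z_unfold:
  fixes \<phi> :: "('i, 'a::comm_ring_1) mfps"
  assumes "mfps_coeff \<phi> 0 = 0"
  shows "subst_z F \<phi> = fps_nth F 0 + \<phi> * subst_z (fps_shift 1 F) \<phi>"
proof (rule mfps_eqI)
  fix \<alpha> :: "'i \<Rightarrow>\<^sub>0 nat"
  define S where "S = (\<Sum>n\<le>mdeg \<alpha>. fps_nth F (Suc n) * \<phi> ^ n)"
  have "mfps_coeff (subst_z F \<phi>) \<alpha> = (\<Sum>n\<le>Suc (mdeg \<alpha>). mfps_coeff (fps_nth F n * \<phi> ^ n) \<alpha>)"
    by (rule coeff_subst_z[OF assms]) simp
  also have "\<dots> = mfps_coeff (fps_nth F 0) \<alpha> + mfps_coeff (\<phi> * S) \<alpha>"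
    by (subst sum.atMost_Suc_shift) (simp add: S_def sum_distrib_left mult_ac)
  also have "mfps_coeff (\<phi> * S) \<alpha> = mfps_coeff (\<phi> * subst_z (fps_shift 1 F) \<phi>) \<alpha>"
    unfolding coeff_mult
  proof (intro sum.cong refl arg_cong2[where f = "(*)"])
    fix p assume "p \<in> splits \<alpha>"
    then have "mdeg (snd p) \<le> mdeg \<alpha>" by (auto simp: mdeg_add)
    then show "mfps_coeff S (snd p) = mfps_coeff (subst_z (fps_shift 1 F) \<phi>) (snd p)"
      by (subst coeff_subst_z[OF assms]) (simp_all add: S_def)
  qed
  finally show "mfps_coeff (subst_z F \<phi>) \<alpha> =
      mfps_coeff (fps_nth F 0 + \<phi> * subst_z (fps_shift 1 F) \<phi>) \<alpha>"
    by simp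
qed

lemma subst_z_0 [simp]: "subst_z F 0 = fps_nth F 0"
  by (subst subst_z_unfold) simp_all

lemma subst_z_X_power:
  fixes \<phi> :: "('i, 'a::comm_ring_1) mfps"
  assumes "mfps_coeff \<phi> 0 = 0"
  shows "subst_z (fps_X ^ l) \<phi> = \<phi> ^ l"
proof (induction l)
  case 0
  have "subst_z 0 \<phi> = 0"
    by (rule mfps_eqI) (simp add: coeff_subst_z[OF assms order.refl])
  moreover have "fps_shift 1 1 = (0 :: ('i, 'a) mfps fps)"
    by (rule fps_ext) simp
  ultimately show ?case
    by (subst subst_z_unfold[OF assms]) simp
next
  case (Suc l)
  have "fps_shift 1 (fps_X ^ Suc l) = (fps_X ^ l :: ('i, 'a) mfps fps)"
    by (rule fps_ext) simp
  then show ?case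
    by (subst subst_z_unfold[OF assms]) (simp add: Suc)
qed

lemma mfps_over_subst_z:
  fixes \<phi> :: "('i, 'a::comm_ring_1) mfps"
  assumes "\<And>n. fps_nth F n \<in> mfps_over I" "\<phi> \<in> mfps_over I" "mfps_coeff \<phi> 0 = 0"
  shows "subst_z F \<phi> \<in> mfps_over I"
  unfolding mfps_over_def
proof (intro CollectI allI impI)
  fix \<alpha> :: "'i \<Rightarrow>\<^sub>0 nat"
  assume "\<not> Poly_Mapping.keys \<alpha> \<subseteq> I"
  moreover have "(\<Sum>n\<le>mdeg \<alpha>. fps_nth F n * \<phi> ^ n) \<in> mfps_over I"
    by (intro mfps_over_sum mfps_over_mult mfps_over_power assms)
  ultimately show "mfps_coeff (subst_z F \<phi>) \<alpha> = 0"
    by (simp add: coeff_subst_z[OF assms(3) order.refl] mfps_over_def)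
qed

section \<open>Existence of the fixed point\<close>

text \<open>
  The term \<open>g\<^sub>n (a\<^sup>n - b\<^sup>n)\<close> gains weight over \<open>a - b\<close>: for \<open>n = 1\<close> from \<open>g\<^sub>1\<close>, for \<open>n \<ge> 2\<close> from the
  cofactor of \<open>a - b\<close> in \<open>a\<^sup>n - b\<^sup>n\<close>.
\<close>

lemma subst_z_contracting:
  assumes "mfps_coeff (fps_nth G 1) 0 = 0" "mfps_coeff a 0 = 0" "mfps_coeff b 0 = 0"
    and "weight_ge N (a - b)"
  shows "weight_ge (Suc N) (subst_z G a - subst_z G b)"
proof -
  have diff: "weight_ge (N + (n - 1) * 2) (a ^ n - b ^ n)" for n
  proof -
    have "weight_ge ((n - 1) * 2) (\<Sum>i<n. b ^ (n - Suc i) * a ^ i)"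
    proof (rule weight_ge_sum)
      fix i assume "i \<in> {..<n}"
      then have "(n - Suc i) * 2 + i * 2 = (n - 1) * 2" by auto
      moreover have "weight_ge ((n - Suc i) * 2 + i * 2) (b ^ (n - Suc i) * a ^ i)"
        by (intro weight_ge_mult weight_ge_power weight_ge_constant_free assms)
      ultimately show "weight_ge ((n - 1) * 2) (b ^ (n - Suc i) * a ^ i)" by simp
    qed
    then show ?thesis
      using assms(4) by (simp add: power_diff_sumr2 weight_ge_mult)
  qed
  have "weight_ge (Suc N) (fps_nth G n * (a ^ n - b ^ n))" for n
  proof -
    consider "n = 0" | "n = 1" | "n \<ge> 2" by linarith
    then show ?thesis
    proof cases
      case 1
      then show ?thesis by (simp add: weight_ge_def)
    next
      case 2
      have "weight_ge (2 + N) (fps_nth G 1 * (a - b))"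
        by (intro weight_ge_mult weight_ge_constant_free assms)
      then show ?thesis using 2 by (auto intro: weight_ge_mono)
    next
      case 3
      have "weight_ge (0 + (N + (n - 1) * 2)) (fps_nth G n * (a ^ n - b ^ n))"
        by (intro weight_ge_mult diff) simp
      then show ?thesis by (rule weight_ge_mono) (use 3 in simp)
    qed
  qed
  then show ?thesis
    by (simp add: weight_ge_def coeff_subst_z[OF assms(2) order.refl]
        coeff_subst_z[OF assms(3) order.refl] right_diff_distrib flip: sum_subtractf)
qed

text \<open>
  The iterates of \<open>\<phi> \<mapsto> G(\<phi>)\<close> from 0 converge, because consecutive differences gain weight.
\<close>

lemma fixed_point_exists:
  fixes G :: "('i, 'a::comm_ring_1) mfps fps"
  assumes over: "\<And>n. fps_nth G n \<in> mfps_over I"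
    and G0: "mfps_coeff (fps_nth G 0) 0 = 0" and G1: "mfps_coeff (fps_nth G 1) 0 = 0"
  obtains \<phi> where "\<phi> \<in> mfps_over I" "mfps_coeff \<phi> 0 = 0" "\<phi> = subst_z G \<phi>"
proof -
  define f where "f n = (subst_z G ^^ n) 0" for n
  have f_Suc: "f (Suc n) = subst_z G (f n)" for n
    by (simp add: f_def)
  have f0: "mfps_coeff (f n) 0 = 0" for n
    by (induction n) (simp_all add: f_Suc coeff_zero_subst_z G0, simp add: f_def)
  have f_over: "f n \<in> mfps_over I" for n
  proof (induction n)
    case (Suc n)
    then show ?case by (simp add: f_Suc mfps_over_subst_z over f0)
  qed (simp add: f_def)
  have step: "weight_ge n (f (Suc n) - f n)" for n
  proof (induction n)
    case (Suc n)
    show ?case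
      using subst_z_contracting[OF G1 f0 f0 Suc] by (simp only: f_Suc)
  qed simp
  have cauchy: "weight_ge n (f m - f n)" if "n \<le> m" for n m
    using that
  proof (induction m rule: dec_induct)
    case base
    show ?case by (simp add: weight_ge_def)
  next
    case (step m)
    have "weight_ge n ((f (Suc m) - f m) + (f m - f n))"
      using \<open>weight_ge m (f (Suc m) - f m)\<close> step by (intro weight_ge_add) (auto intro: weight_ge_mono)
    then show ?case by simp
  qed
  \<comment> \<open>the coefficient at \<open>w\<^sup>\<alpha>\<close> no longer changes once differences have weight above \<open>2|\<alpha>|\<close>\<close>
  define \<phi> where "\<phi> = Abs_mfps (\<lambda>\<alpha>. mfps_coeff (f (Suc (2 * mdeg \<alpha>))) \<alpha>)"
  have coeff_\<phi>: "mfps_coeff \<phi> \<alpha> = mfps_coeff (f (Suc (2 * mdeg \<alpha>))) \<alpha>" for \<alpha>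
    by (simp add: \<phi>_def Abs_mfps_inverse)
  have \<phi>0: "mfps_coeff \<phi> 0 = 0"
    by (simp add: coeff_\<phi> f0)
  have limit: "weight_ge n (\<phi> - f n)" for n
    unfolding weight_ge_def
  proof (intro allI impI)
    fix \<alpha> :: "'i \<Rightarrow>\<^sub>0 nat"
    assume "2 * mdeg \<alpha> < n"
    then have "weight_ge (Suc (2 * mdeg \<alpha>)) (f n - f (Suc (2 * mdeg \<alpha>)))"
      by (intro cauchy) simp
    then show "mfps_coeff (\<phi> - f n) \<alpha> = 0"
      by (simp add: coeff_\<phi> weight_ge_def)
  qed
  have "weight_ge n (subst_z G \<phi> - \<phi>)" for n
  proof -
    have "weight_ge n ((subst_z G \<phi> - f (Suc n)) - (\<phi> - f (Suc n)))"
      using subst_z_contracting[OF G1 \<phi>0 f0 limit, of n] limit[of "Suc n"]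
      by (intro weight_ge_diff[of n "subst_z G \<phi> - f (Suc n)"])
        (auto simp: f_Suc intro: weight_ge_mono)
    then show ?thesis by simp
  qed
  then have "mfps_coeff (subst_z G \<phi> - \<phi>) \<alpha> = 0" for \<alpha>
    unfolding weight_ge_def by blast
  then have "\<phi> = subst_z G \<phi>"
    by (intro mfps_eqI) simp
  moreover have "\<phi> \<in> mfps_over I"
    using f_over by (simp add: mfps_over_def coeff_\<phi>)
  ultimately show ?thesis using \<phi>0 that by blast
qed

section \<open>Division by z - G\<close>

lemma unit_of_constant_coeff_1:
  fixes u :: "('i, 'a::comm_ring_1) mfps"
  assumes "mfps_coeff u 0 = 0"
  obtains v where "(1 - u) * v = 1"
proof -
  \<comment> \<open>the geometric series in \<open>u\<close>\<close>
  let ?E = "Abs_fps (\<lambda>_. 1 :: ('i, 'a) mfps)"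
  have "fps_shift 1 ?E = ?E"
    by (rule fps_ext) simp
  then have "subst_z ?E u = 1 + u * subst_z ?E u"
    using subst_z_unfold[OF assms, of ?E] by simp
  then have "(1 - u) * subst_z ?E u = 1"
    by (simp add: algebra_simps)
  then show ?thesis using that by blast
qed

text \<open>
  The quotient is given by Horner's scheme: its \<open>n\<close>-th coefficient is the value at \<open>\<phi>\<close> of the tail of
  \<open>F\<close> beyond \<open>z\<^sup>n\<close>.
\<close>

lemma division_by_linear:
  assumes "mfps_coeff \<phi> 0 = 0"
  shows "F - fps_const (subst_z F \<phi>) =
    (fps_X - fps_const \<phi>) * Abs_fps (\<lambda>n. subst_z (fps_shift (Suc n) F) \<phi>)"
proof (rule fps_ext)
  fix n
  have "fps_shift 1 (fps_shift k F) = fps_shift (Suc k) F" for k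
    by (rule fps_ext) simp
  then have "subst_z (fps_shift k F) \<phi> = fps_nth F k + \<phi> * subst_z (fps_shift (Suc k) F) \<phi>" for k
    using subst_z_unfold[OF assms, of "fps_shift k F"] by simp
  from this[of n] this[of 0] show "fps_nth (F - fps_const (subst_z F \<phi>)) n =
      fps_nth ((fps_X - fps_const \<phi>) * Abs_fps (\<lambda>n. subst_z (fps_shift (Suc n) F) \<phi>)) n"
    by (cases n) (simp_all add: left_diff_distrib)
qed

text \<open>
  Applied to \<open>G\<close> itself, division by \<open>z - \<phi>\<close> shows that \<open>z - G\<close> is \<open>z - \<phi>\<close> times a unit, because
  \<open>g\<^sub>1(0) = 0\<close>. Hence \<open>z - G\<close> can take the place of \<open>z - \<phi>\<close> as the divisor.
\<close>

lemma division_by_fixed_point_equation: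
  fixes G H :: "('i, 'a::comm_ring_1) mfps fps"
  assumes G1: "mfps_coeff (fps_nth G 1) 0 = 0"
    and \<phi>0: "mfps_coeff \<phi> 0 = 0" and fix_G: "\<phi> = subst_z G \<phi>"
  obtains K where "H = fps_const (subst_z H \<phi>) + (fps_X - G) * K"
proof -
  define Q where "Q F = Abs_fps (\<lambda>n. subst_z (fps_shift (Suc n) F) \<phi>)" for F
  have Q: "F - fps_const (subst_z F \<phi>) = (fps_X - fps_const \<phi>) * Q F" for F
    using division_by_linear[OF \<phi>0, of F] by (simp add: Q_def)
  have "mfps_coeff (fps_nth (Q G) 0) 0 = 0"
    by (simp add: Q_def coeff_zero_subst_z[OF \<phi>0] G1[simplified])
  then obtain v where "(1 - fps_nth (Q G) 0) * v = 1"
    by (rule unit_of_constant_coeff_1)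
  then have "fps_nth (1 - Q G) 0 * v = 1"
    by simp
  from fps_right_inverse[OF this] obtain U where U: "(1 - Q G) * U = 1"
    by blast
  have "fps_X - G = (fps_X - fps_const \<phi>) - (G - fps_const (subst_z G \<phi>))"
    using fix_G by simp
  also have "\<dots> = (fps_X - fps_const \<phi>) * (1 - Q G)"
    unfolding Q by (simp add: algebra_simps)
  finally have "(fps_X - G) * (U * Q H) = (fps_X - fps_const \<phi>) * ((1 - Q G) * U) * Q H"
    by (simp only: mult_ac)
  also have "\<dots> = H - fps_const (subst_z H \<phi>)"
    by (simp add: U Q)
  finally have "H = fps_const (subst_z H \<phi>) + (fps_X - G) * (U * Q H)"
    by simp
  then show ?thesis by (rule that)
qed

section \<open>The telescoping sum\<close>

text \<open>
  Multiplication by \<open>z - G\<close> makes consecutive terms cancel, since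
  \<open>(z - G)(G\<^sup>m - z G' G\<^bsup>m-1\<^esup>) = z G\<^bsup>m-1\<^esup>(G - z G') - G\<^sup>m (G - z G')\<close> and \<open>[z\<^sup>m]\<close> of the first summand
  is \<open>[z\<^bsup>m-1\<^esup>]\<close> of the second one, without its sign, for \<open>m - 1\<close>. The term at \<open>z\<^sup>0\<close> starts the chain.
\<close>

lemma telescoping_coefficients:
  fixes G K :: "'b::comm_ring_1 fps"
  shows "fps_nth ((fps_X - G) * K) 0 +
      (\<Sum>m=1..M. fps_nth ((fps_X - G) * K * (G ^ m - fps_X * fps_deriv G * G ^ (m - 1))) m) =
    - fps_nth (K * G ^ M * (G - fps_X * fps_deriv G)) M"
proof (induction M)
  case (Suc M)
  let ?D = "fps_X * fps_deriv G"
  have "(fps_X - G) * K * (G ^ Suc M - ?D * G ^ M) =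
      fps_X * (K * G ^ M * (G - ?D)) - K * G ^ Suc M * (G - ?D)"
    by (simp add: algebra_simps)
  then have "fps_nth ((fps_X - G) * K * (G ^ Suc M - ?D * G ^ M)) (Suc M) =
      fps_nth (K * G ^ M * (G - ?D)) M - fps_nth (K * G ^ Suc M * (G - ?D)) (Suc M)"
    by (simp only: fps_sub_nth fps_X_mult_nth) simp
  moreover have "(\<Sum>m=1..Suc M. fps_nth ((fps_X - G) * K * (G ^ m - ?D * G ^ (m - 1))) m) =
      (\<Sum>m=1..M. fps_nth ((fps_X - G) * K * (G ^ m - ?D * G ^ (m - 1))) m) +
      fps_nth ((fps_X - G) * K * (G ^ Suc M - ?D * G ^ M)) (Suc M)"
    by simp
  ultimately show ?case
    using Suc by (simp only: add.assoc[symmetric]) simp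
qed (simp add: algebra_simps)

section \<open>Words, cyclic shifts and the numbers c\<close>

lemma natpermute_Suc:
  "natpermute n (Suc m) = (\<Union>i\<in>{0..n}. (#) i ` natpermute (n - i) m)"
proof (rule set_eqI)
  fix xs show "xs \<in> natpermute n (Suc m) \<longleftrightarrow> xs \<in> (\<Union>i\<in>{0..n}. (#) i ` natpermute (n - i) m)"
    by (cases xs) (auto simp: natpermute_def image_iff)
qed

lemma fps_nth_mult_power_words:
  fixes F G :: "'b::comm_ring_1 fps"
  shows "fps_nth (F * G ^ m) n =
    (\<Sum>xs\<in>natpermute n (Suc m). fps_nth F (hd xs) * prod_list (map (fps_nth G) (tl xs)))"
proof (induction m arbitrary: F n)
  case (Suc m)
  have "fps_nth (F * G ^ Suc m) n = (\<Sum>i=0..n. fps_nth F i * fps_nth (G * G ^ m) (n - i))"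
    by (simp add: fps_mult_nth)
  also have "\<dots> = (\<Sum>i=0..n. \<Sum>xs\<in>(#) i ` natpermute (n - i) (Suc m).
      fps_nth F (hd xs) * prod_list (map (fps_nth G) (tl xs)))"
  proof (rule sum.cong)
    fix i
    have "fps_nth (G * G ^ m) (n - i) =
        (\<Sum>xs\<in>natpermute (n - i) (Suc m). prod_list (map (fps_nth G) xs))"
      unfolding Suc
    proof (rule sum.cong)
      fix xs assume "xs \<in> natpermute (n - i) (Suc m)"
      then show "fps_nth G (hd xs) * prod_list (map (fps_nth G) (tl xs)) = prod_list (map (fps_nth G) xs)"
        by (cases xs) (auto simp: natpermute_def)
    qed simp
    then show "fps_nth F i * fps_nth (G * G ^ m) (n - i) = (\<Sum>xs\<in>(#) i ` natpermute (n - i) (Suc m).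
        fps_nth F (hd xs) * prod_list (map (fps_nth G) (tl xs)))"
      by (simp add: sum.reindex sum_distrib_left)
  qed simp
  also have "\<dots> = (\<Sum>xs\<in>natpermute n (Suc (Suc m)).
      fps_nth F (hd xs) * prod_list (map (fps_nth G) (tl xs)))"
    unfolding natpermute_Suc[of n "Suc m"]
    by (rule sum.UNION_disjoint[symmetric]) (auto simp: natpermute_finite)
  finally show ?case .
qed simp

text \<open>
  The letters of a word of length \<open>m\<close> select the powers of \<open>z\<close> in the \<open>m\<close> factors \<open>G\<close>; the operator
  \<open>z d/dz\<close> acts on the factor of the first letter.
\<close>

lemma fps_nth_lagrange_words:
  fixes G :: "'b::comm_ring_1 fps"
  assumes "m \<ge> 1"
  shows "fps_nth (G ^ m - fps_X * fps_deriv G * G ^ (m - 1)) n =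
    (\<Sum>xs\<in>natpermute n m. of_int (1 - int (hd xs)) * prod_list (map (fps_nth G) xs))"
proof -
  obtain m' where m: "m = Suc m'" using assms by (cases m) auto
  have nth: "fps_nth (G - fps_X * fps_deriv G) i = of_int (1 - int i) * fps_nth G i" for i
    by (cases i) (simp_all add: algebra_simps)
  have "G ^ m - fps_X * fps_deriv G * G ^ (m - 1) = (G - fps_X * fps_deriv G) * G ^ m'"
    by (simp add: m algebra_simps)
  also have "fps_nth \<dots> n =
      (\<Sum>xs\<in>natpermute n m. of_int (1 - int (hd xs)) * prod_list (map (fps_nth G) xs))"
    unfolding fps_nth_mult_power_words m[symmetric]
  proof (rule sum.cong)
    fix xs assume "xs \<in> natpermute n m"
    then show "fps_nth (G - fps_X * fps_deriv G) (hd xs) * prod_list (map (fps_nth G) (tl xs)) =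
        of_int (1 - int (hd xs)) * prod_list (map (fps_nth G) xs)"
      by (cases xs) (auto simp: natpermute_def m nth mult.assoc simp del: fps_sub_nth)
  qed simp
  finally show ?thesis .
qed

text \<open>
  The coefficient that the words with letters \<open>A\<close> give to their common monomial in
  \<open>fps_nth_lagrange_words\<close>.
\<close>

definition head_excess :: "nat multiset \<Rightarrow> int" where
  "head_excess A = (\<Sum>xs\<in>permutations_of_multiset A. 1 - int (hd xs))"

text \<open>
  Cyclic shifts permute the arrangements of \<open>A\<close>, so each position contributes to the sum of \<open>1 - x\<close>
  over all letters as much as the first one does. This replaces division by the length, which
  is not available in the coefficient ring.
\<close>

lemma size_mult_head_excess:
  "int (size A) * head_excess A =
     int (card (permutations_of_multiset A)) * (int (size A) - int (\<Sum>\<^sub># A))"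
proof -
  let ?P = "permutations_of_multiset A"
  have shift: "(\<Sum>xs\<in>?P. 1 - int (xs ! i)) = head_excess A" if "i < size A" for i
  proof -
    have "bij_betw (rotate i) ?P ?P"
      unfolding bij_betw_def
    proof
      show "inj_on (rotate i) ?P"
        unfolding rotate_def by (rule inj_on_subset[OF inj_fn[OF inj_rotate1]]) simp
      moreover have "mset (rotate1 xs) = mset xs" for xs :: "nat list"
        by (cases xs) simp_all
      then have "mset (rotate i xs) = mset xs" for xs :: "nat list"
        by (induction i) simp_all
      ultimately show "rotate i ` ?P = ?P"
        by (intro endo_inj_surj finite_permutations_of_multiset)
          (auto simp: permutations_of_multiset_def)
    qed
    then have "head_excess A = (\<Sum>xs\<in>?P. 1 - int (hd (rotate i xs)))"
      unfolding head_excess_def by (rule sum.reindex_bij_betw[symmetric])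
    also have "\<dots> = (\<Sum>xs\<in>?P. 1 - int (xs ! i))"
    proof (rule sum.cong)
      fix xs assume "xs \<in> ?P"
      then have "length xs = size A" by (rule length_finite_permutations_of_multiset)
      then show "1 - int (hd (rotate i xs)) = 1 - int (xs ! i)"
        using that by (subst hd_rotate_conv_nth) auto
    qed simp
    finally show ?thesis by simp
  qed
  have "int (size A) * head_excess A = (\<Sum>i<size A. \<Sum>xs\<in>?P. 1 - int (xs ! i))"
    by (simp add: shift)
  also have "\<dots> = (\<Sum>xs\<in>?P. \<Sum>i<size A. 1 - int (xs ! i))"
    by (rule sum.swap)
  also have "\<dots> = (\<Sum>xs\<in>?P. int (size A) - int (\<Sum>\<^sub># A))"
  proof (rule sum.cong)
    fix xs assume "xs \<in> ?P"
    then have A: "A = mset xs" by (simp add: permutations_of_multiset_def)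
    show "(\<Sum>i<size A. 1 - int (xs ! i)) = int (size A) - int (\<Sum>\<^sub># A)"
      by (simp add: A sum_subtractf sum_mset_sum_list sum_list_sum_nth atLeast0LessThan)
  qed simp
  finally show ?thesis by simp
qed

text \<open>
  The exponents \<open>k\<close> of a monomial \<open>\<Prod>\<^sub>n g\<^sub>n\<^bsup>k\<^sub>n\<^esup>\<close>, as the multiset of letters of the words that
  produce it.
\<close>

definition letters :: "(nat \<Rightarrow>\<^sub>0 nat) \<Rightarrow> nat multiset" where
  "letters k = Abs_multiset (Poly_Mapping.lookup k)"

lemma count_letters [simp]: "count (letters k) n = Poly_Mapping.lookup k n"
  using finite_lookup[of k] by (simp add: letters_def count_Abs_multiset)

lemma set_mset_letters [simp]: "set_mset (letters k) = Poly_Mapping.keys k"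
  by (auto simp: set_mset_def in_keys_iff)

lemma bij_letters: "bij letters"
proof (rule bijI)
  show "inj letters"
    by (metis count_letters injI poly_mapping_eqI)
  have "letters (Abs_poly_mapping (count A)) = A" for A
    by (rule multiset_eqI) simp
  then show "surj letters"
    by (metis surj_def)
qed

lemma size_letters: "size (letters k) = (\<Sum>n\<in>Poly_Mapping.keys k. Poly_Mapping.lookup k n)"
  by (simp add: size_multiset_overloaded_eq)

lemma sum_mset_eq_sum_count:
  fixes A :: "nat multiset"
  assumes "finite S" "set_mset A \<subseteq> S"
  shows "\<Sum>\<^sub># A = (\<Sum>n\<in>S. n * count A n)"
  using assms(2)
proof (induction A)
  case (add x A)
  have "(\<Sum>n\<in>S. n * count (add_mset x A) n) = (\<Sum>n\<in>S. n * count A n + (if x = n then n else 0))"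
    by (rule sum.cong) auto
  also have "\<dots> = \<Sum>\<^sub># A + x"
    using add assms(1) by (simp add: sum.distrib)
  finally show ?case by simp
qed simp

lemma sum_mset_letters:
  "\<Sum>\<^sub># (letters k) = (\<Sum>n\<in>Poly_Mapping.keys k. n * Poly_Mapping.lookup k n)"
  by (subst sum_mset_eq_sum_count[of "Poly_Mapping.keys k"]) simp_all

text \<open>
  The integer \<open>head_excess\<close> satisfies \<open>m head_excess = l m!/\<Prod>\<^sub>n k\<^sub>n!\<close>, where \<open>m\<close> is the number of letters;
  over the rationals \<open>m\<close> can be cancelled.
\<close>

lemma lagrange_c_eq_head_excess:
  assumes "l \<ge> 1"
  shows "lagrange_c l k =
    of_int (if \<Sum>\<^sub># (letters k) + l = size (letters k) then head_excess (letters k) else 0)"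
proof -
  let ?A = "letters k"
  have "(\<Sum>n\<in>Poly_Mapping.keys k. (int n - 1) * int (Poly_Mapping.lookup k n)) =
      int (\<Sum>\<^sub># ?A) - int (size ?A)"
    by (simp add: size_letters sum_mset_letters left_diff_distrib sum_subtractf)
  then have cond: "(\<Sum>n\<in>Poly_Mapping.keys k. (int n - 1) * int (Poly_Mapping.lookup k n)) = - int l
      \<longleftrightarrow> \<Sum>\<^sub># ?A + l = size ?A"
    by linarith
  show ?thesis
  proof (cases "\<Sum>\<^sub># ?A + l = size ?A")
    case True
    let ?N = "card (permutations_of_multiset ?A)" and ?F = "\<Prod>n\<in>Poly_Mapping.keys k. fact (Poly_Mapping.lookup k n)"
    have "of_nat (?N * ?F) = (of_nat (fact (size ?A)) :: rat)"
      using card_permutations_of_multiset_aux[of ?A] by simp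
    then have N: "of_nat ?N * ?F = (fact (size ?A) :: rat)"
      by (simp add: of_nat_prod)
    have size: "size ?A \<ge> 1" using True assms by linarith
    then have fact: "(fact (size ?A) :: rat) = of_nat (size ?A) * fact (size ?A - 1)"
      by (simp add: fact_reduce)
    have "int (size ?A) - int (\<Sum>\<^sub># ?A) = int l" using True by linarith
    then have "of_int (int (size ?A) * head_excess ?A) = (of_int (int ?N * int l) :: rat)"
      unfolding size_mult_head_excess by simp
    then have "of_nat (size ?A) * (of_int (head_excess ?A) * ?F) = of_nat l * (of_nat ?N * ?F :: rat)"
      by simp
    also have "\<dots> = of_nat (size ?A) * (of_nat l * fact (size ?A - 1))"
      by (simp only: N fact mult_ac)
    finally have "of_int (head_excess ?A) * ?F = (of_nat l * fact (size ?A - 1) :: rat)"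
      using size by auto
    moreover have "?F \<noteq> (0 :: rat)" by simp
    ultimately have "of_int (head_excess ?A) = of_nat l * (fact (size ?A - 1) / ?F :: rat)"
      by (simp add: field_simps)
    then show ?thesis
      using True cond by (simp add: lagrange_c_def flip: size_letters)
  qed (use cond in \<open>simp add: lagrange_c_def\<close>)
qed

definition lagrange_indices :: "nat \<Rightarrow> nat \<Rightarrow> (nat \<Rightarrow>\<^sub>0 nat) set" where
  "lagrange_indices l m = {k. size (letters k) = m \<and> \<Sum>\<^sub># (letters k) + l = m}"

lemma lagrange_term_eq:
  assumes "l \<ge> 1"
  shows "lagrange_term g l k =
    (if k \<in> lagrange_indices l (size (letters k))
     then of_int (head_excess (letters k)) * (\<Prod>n\<in>#letters k. g n) else 0)"
  using assms
  by (simp add: lagrange_term_def lagrange_c_eq_head_excess lagrange_indices_def image_prod_mset_multiplicity)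

lemma lagrange_indices_eq_vimage:
  assumes "n + l = m"
  shows "lagrange_indices l m = letters -` mset ` natpermute n m"
proof (rule set_eqI)
  fix k
  obtain xs where "mset xs = letters k" using ex_mset by blast
  then show "k \<in> lagrange_indices l m \<longleftrightarrow> k \<in> letters -` mset ` natpermute n m"
    using assms by (auto simp: lagrange_indices_def natpermute_def image_iff
        simp flip: sum_mset_sum_list size_mset intro!: exI[of _ xs])
qed

lemma finite_lagrange_indices: "finite (lagrange_indices l m)"
proof (cases "l \<le> m")
  case True
  then have "lagrange_indices l m = letters -` mset ` natpermute (m - l) m"
    by (intro lagrange_indices_eq_vimage) simp
  then show ?thesis
    using bij_letters by (simp add: finite_vimageI natpermute_finite bij_is_inj)
qed (simp add: lagrange_indices_def)

text \<open>
  The monomial of a word depends only on its multiset of letters, and every arrangement of the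
  letters of a word in \<open>natpermute n m\<close> is again in that set; so the sum over words splits into
  complete sets of arrangements.
\<close>

lemma fps_nth_lagrange_multisets:
  fixes G :: "'b::comm_ring_1 fps"
  assumes "m \<ge> 1" "n + l = m"
  shows "fps_nth (G ^ m - fps_X * fps_deriv G * G ^ (m - 1)) n =
    (\<Sum>k\<in>lagrange_indices l m. of_int (head_excess (letters k)) * (\<Prod>i\<in>#letters k. fps_nth G i))"
proof -
  let ?h = "\<lambda>xs. of_int (1 - int (hd xs)) * prod_list (map (fps_nth G) xs)"
  have "fps_nth (G ^ m - fps_X * fps_deriv G * G ^ (m - 1)) n = (\<Sum>xs\<in>natpermute n m. ?h xs)"
    by (rule fps_nth_lagrange_words[OF assms(1)])
  also have "\<dots> = (\<Sum>A\<in>mset ` natpermute n m. \<Sum>xs\<in>{xs \<in> natpermute n m. mset xs = A}. ?h xs)"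
    by (rule sum.image_gen[OF natpermute_finite])
  also have "\<dots> = (\<Sum>A\<in>mset ` natpermute n m. of_int (head_excess A) * (\<Prod>i\<in>#A. fps_nth G i))"
  proof (rule sum.cong)
    fix A assume "A \<in> mset ` natpermute n m"
    then have eq: "{xs \<in> natpermute n m. mset xs = A} = permutations_of_multiset A"
      by (auto simp: natpermute_def permutations_of_multiset_def
          simp flip: sum_mset_sum_list size_mset)
    have "?h xs = of_int (1 - int (hd xs)) * (\<Prod>i\<in>#A. fps_nth G i)"
      if "xs \<in> permutations_of_multiset A" for xs
      using permutations_of_multisetD[OF that] by (auto simp flip: prod_mset_prod_list)
    then show "(\<Sum>xs\<in>{xs \<in> natpermute n m. mset xs = A}. ?h xs) =
        of_int (head_excess A) * (\<Prod>i\<in>#A. fps_nth G i)"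
      unfolding eq by (simp add: head_excess_def sum_distrib_right)
  qed simp
  also have "mset ` natpermute n m = letters ` lagrange_indices l m"
    unfolding lagrange_indices_eq_vimage[OF assms(2)]
    using bij_letters by (simp add: bij_def surj_image_vimage_eq)
  also have "(\<Sum>A\<in>letters ` lagrange_indices l m. of_int (head_excess A) * (\<Prod>i\<in>#A. fps_nth G i)) =
      (\<Sum>k\<in>lagrange_indices l m. of_int (head_excess (letters k)) * (\<Prod>i\<in>#letters k. fps_nth G i))"
    using bij_letters by (subst sum.reindex) (auto simp: bij_def intro: inj_on_subset)
  finally show ?thesis .
qed

text \<open>
  Multiplied by \<open>m\<close>, this is a coefficient of the identity \<open>m G' G\<^bsup>m-1\<^esup> = (G\<^sup>m)'\<close>. To avoid
  cancelling \<open>m\<close> in the ring, one expands into words: those that occur have length equal to their sum, and \<open>size_mult_head_excess\<close> makes their integer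
  coefficients vanish before these are mapped to the ring.
\<close>

lemma lagrange_diagonal_coefficient_eq_0:
  fixes G :: "'b::comm_ring_1 fps"
  assumes "m \<ge> 1"
  shows "fps_nth (G ^ m - fps_X * fps_deriv G * G ^ (m - 1)) m = 0"
proof -
  have "head_excess (letters k) = 0" if "k \<in> lagrange_indices 0 m" for k
    using that size_mult_head_excess[of "letters k"] assms by (auto simp: lagrange_indices_def)
  then show ?thesis
    by (subst fps_nth_lagrange_multisets[where l = 0]) (use assms in auto)
qed

lemma fps_nth_X_power_lagrange:
  assumes "l \<ge> 1" "m \<ge> 1"
  shows "fps_nth (fps_X ^ l * (G ^ m - fps_X * fps_deriv G * G ^ (m - 1))) m =
    (\<Sum>k\<in>lagrange_indices l m. lagrange_term (fps_nth G) l k)"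
proof (cases "l \<le> m")
  case True
  then have "fps_nth (fps_X ^ l * (G ^ m - fps_X * fps_deriv G * G ^ (m - 1))) m =
      (\<Sum>k\<in>lagrange_indices l m. of_int (head_excess (letters k)) * (\<Prod>i\<in>#letters k. fps_nth G i))"
    using fps_nth_lagrange_multisets[OF assms(2), of "m - l" l G]
    by (simp add: fps_X_power_mult_nth del: fps_sub_nth)
  also have "\<dots> = (\<Sum>k\<in>lagrange_indices l m. lagrange_term (fps_nth G) l k)"
    by (rule sum.cong) (auto simp: lagrange_term_eq[OF assms(1)] lagrange_indices_def)
  finally show ?thesis .
next
  case False
  then have "lagrange_indices l m = {}" by (auto simp: lagrange_indices_def)
  then show ?thesis using False by (simp add: fps_X_power_mult_nth)
qed

section \<open>Lagrange inversion\<close>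

context
  fixes G :: "('i, 'a::comm_ring_1) mfps fps"
  assumes G0: "mfps_coeff (fps_nth G 0) 0 = 0" and G1: "mfps_coeff (fps_nth G 1) 0 = 0"
begin

lemma weight_ge_coeff: "weight_ge (2 - n) (fps_nth G n)"
proof -
  consider "n = 0" | "n = 1" | "n \<ge> 2" by linarith
  then show ?thesis
  proof cases
    case 1
    then show ?thesis using weight_ge_constant_free[OF G0] by simp
  next
    case 2
    then show ?thesis using weight_ge_mono[OF weight_ge_constant_free[OF G1], of 1] by simp
  qed simp
qed

lemma zweight_ge_G: "zweight_ge 2 G"
  and zweight_ge_zdG: "zweight_ge 2 (fps_X * fps_deriv G)"
proof -
  show "zweight_ge 2 G"
    by (simp add: zweight_ge_def weight_ge_coeff)
  have nth: "fps_nth (fps_X * fps_deriv G) n = of_nat n * fps_nth G n" for n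
    by (cases n) simp_all
  have "weight_ge (0 + (2 - n)) (of_nat n * fps_nth G n)" for n
    by (intro weight_ge_mult weight_ge_coeff) simp
  then show "zweight_ge 2 (fps_X * fps_deriv G)"
    unfolding zweight_ge_def nth by simp
qed

lemma weight_ge_prod_mset: "weight_ge (2 * size A - \<Sum>\<^sub># A) (\<Prod>n\<in>#A. fps_nth G n)"
proof (induction A)
  case (add n A)
  have "weight_ge ((2 - n) + (2 * size A - \<Sum>\<^sub># A)) (\<Prod>n\<in>#add_mset n A. fps_nth G n)"
    using weight_ge_mult[OF weight_ge_coeff add] by simp
  then show ?case by (rule weight_ge_mono) simp
qed simp

text \<open>
  A word of length \<open>m\<close> and sum \<open>m - l\<close> has a monomial of weight at least \<open>2 m - (m - l) = m + l\<close>.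
\<close>

lemma coeff_lagrange_term_eq_0:
  assumes "l \<ge> 1" "2 * mdeg \<alpha> < size (letters k)"
  shows "mfps_coeff (lagrange_term (fps_nth G) l k) \<alpha> = 0"
proof (cases "k \<in> lagrange_indices l (size (letters k))")
  case True
  then have "2 * mdeg \<alpha> < 2 * size (letters k) - \<Sum>\<^sub># (letters k)"
    using assms by (simp add: lagrange_indices_def)
  moreover have "weight_ge (0 + (2 * size (letters k) - \<Sum>\<^sub># (letters k)))
      (of_int (head_excess (letters k)) * (\<Prod>n\<in>#letters k. fps_nth G n))"
    by (intro weight_ge_mult weight_ge_prod_mset) simp
  ultimately show ?thesis
    using True by (simp add: lagrange_term_eq[OF assms(1)] weight_ge_def)
qed (simp add: lagrange_term_eq[OF assms(1)])

text \<open>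
  By \<open>telescoping_coefficients\<close>, the multiple of \<open>z - G\<close> in \<open>H = H(\<phi>) + (z - G) K\<close> contributes only
  the boundary term of the telescoping sum, which has too high a weight to reach \<open>w\<^sup>\<alpha>\<close>. The summand
  \<open>H(\<phi>)\<close>, constant in \<open>z\<close>, contributes only to \<open>[z\<^sup>0] H\<close>, by \<open>lagrange_diagonal_coefficient_eq_0\<close>.
\<close>

lemma coeff_subst_fixed_point:
  assumes \<phi>0: "mfps_coeff \<phi> 0 = 0" and fix_G: "\<phi> = subst_z G \<phi>"
  shows "mfps_coeff (subst_z H \<phi>) \<alpha> = mfps_coeff (subst_z H 0) \<alpha> +
    (\<Sum>m=1..2 * mdeg \<alpha>. coeff_zw m \<alpha> (H * (G ^ m - fps_X * fps_deriv G * G ^ (m - 1))))"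
proof -
  let ?L = "\<lambda>m. G ^ m - fps_X * fps_deriv G * G ^ (m - 1)"
  let ?M = "2 * mdeg \<alpha>"
  obtain K where K: "H = fps_const (subst_z H \<phi>) + (fps_X - G) * K"
    by (rule division_by_fixed_point_equation[OF G1 \<phi>0 fix_G])
  have "fps_nth (H * ?L m) m = fps_nth ((fps_X - G) * K * ?L m) m" if "m \<in> {1..?M}" for m
  proof -
    have "H * ?L m = fps_const (subst_z H \<phi>) * ?L m + (fps_X - G) * K * ?L m"
      by (subst K) (simp only: distrib_right)
    moreover have "fps_nth (fps_const (subst_z H \<phi>) * ?L m) m = 0"
      using lagrange_diagonal_coefficient_eq_0[of m G] that by (simp del: fps_sub_nth)
    ultimately show ?thesis by (simp del: fps_sub_nth)
  qed
  then have "fps_nth H 0 + (\<Sum>m=1..?M. fps_nth (H * ?L m) m) =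
      subst_z H \<phi> + (fps_nth ((fps_X - G) * K) 0 + (\<Sum>m=1..?M. fps_nth ((fps_X - G) * K * ?L m) m))"
    by (subst (1) K) (simp add: add.assoc del: fps_sub_nth fps_mult_nth_0)
  also have "\<dots> = subst_z H \<phi> - fps_nth (K * G ^ ?M * (G - fps_X * fps_deriv G)) ?M"
    unfolding telescoping_coefficients by simp
  finally have "fps_nth H 0 + (\<Sum>m=1..?M. fps_nth (H * ?L m) m) =
      subst_z H \<phi> - fps_nth (K * G ^ ?M * (G - fps_X * fps_deriv G)) ?M" .
  from arg_cong[OF this, of "\<lambda>f. mfps_coeff f \<alpha>"]
  have "mfps_coeff (fps_nth H 0) \<alpha> + (\<Sum>m=1..?M. coeff_zw m \<alpha> (H * ?L m)) =
      mfps_coeff (subst_z H \<phi>) \<alpha> - mfps_coeff (fps_nth (K * G ^ ?M * (G - fps_X * fps_deriv G)) ?M) \<alpha>"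
    by (simp only: mfps_coeff_simps coeff_zw_def)
  moreover have "zweight_ge (0 + ?M * 2 + 2) (K * G ^ ?M * (G - fps_X * fps_deriv G))"
    by (intro zweight_ge_mult zweight_ge_power zweight_ge_diff zweight_ge_G zweight_ge_zdG) simp
  then have "mfps_coeff (fps_nth (K * G ^ ?M * (G - fps_X * fps_deriv G)) ?M) \<alpha> = 0"
    by (rule coeff_eq_0_of_zweight_ge) simp
  ultimately show ?thesis by simp
qed

lemma coeff_fixed_point:
  assumes "mfps_coeff \<phi> 0 = 0" "\<phi> = subst_z G \<phi>"
  shows "mfps_coeff \<phi> \<alpha> = (\<Sum>m=1..2 * mdeg \<alpha>.
    coeff_zw (m - 1) \<alpha> (G ^ m - fps_X * fps_deriv G * G ^ (m - 1)))"
proof -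
  have "mfps_coeff (subst_z fps_X \<phi>) \<alpha> = (\<Sum>m=1..2 * mdeg \<alpha>.
      coeff_zw m \<alpha> (fps_X * (G ^ m - fps_X * fps_deriv G * G ^ (m - 1))))"
    using coeff_subst_fixed_point[OF assms, of fps_X \<alpha>] by simp
  also have "\<dots> = (\<Sum>m=1..2 * mdeg \<alpha>.
      coeff_zw (m - 1) \<alpha> (G ^ m - fps_X * fps_deriv G * G ^ (m - 1)))"
    by (rule sum.cong) (auto simp: coeff_zw_def simp del: fps_sub_nth)
  finally show ?thesis
    using subst_z_X_power[OF assms(1), of 1] by simp
qed

lemma power_fixed_point:
  assumes "mfps_coeff \<phi> 0 = 0" "\<phi> = subst_z G \<phi>" "l \<ge> 1"
  shows "formal_summable (lagrange_term (fps_nth G) l)"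
    and "\<phi> ^ l = formal_sum (lagrange_term (fps_nth G) l)"
proof -
  let ?t = "lagrange_term (fps_nth G) l"
  \<comment> \<open>a finite set outside which all terms vanish at \<open>w\<^sup>\<alpha>\<close>, by weight\<close>
  define A where "A \<alpha> = (\<Union>m\<in>{1..2 * mdeg \<alpha>}. lagrange_indices l m)" for \<alpha> :: "'i \<Rightarrow>\<^sub>0 nat"
  have fin: "finite (A \<alpha>)" for \<alpha>
    by (simp add: A_def finite_lagrange_indices)
  have zero: "mfps_coeff (?t k) \<alpha> = 0" if "k \<notin> A \<alpha>" for k \<alpha>
  proof (rule ccontr)
    assume nz: "mfps_coeff (?t k) \<alpha> \<noteq> 0"
    then have "k \<in> lagrange_indices l (size (letters k))"
      by (auto simp: lagrange_term_eq[OF assms(3)] split: if_splits)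
    moreover have "size (letters k) \<le> 2 * mdeg \<alpha>"
      using nz coeff_lagrange_term_eq_0[OF assms(3)] by (meson not_le)
    ultimately have "k \<in> A \<alpha>"
      using assms(3) by (auto simp: A_def lagrange_indices_def)
    then show False using that by simp
  qed
  then have "{k. mfps_coeff (?t k) \<alpha> \<noteq> 0} \<subseteq> A \<alpha>" for \<alpha>
    by blast
  then show "formal_summable ?t"
    unfolding formal_summable_def using fin finite_subset by blast
  show "\<phi> ^ l = formal_sum ?t"
  proof (rule mfps_eqI)
    fix \<alpha> :: "'i \<Rightarrow>\<^sub>0 nat"
    have "mfps_coeff (\<phi> ^ l) \<alpha> = (\<Sum>m=1..2 * mdeg \<alpha>. mfps_coeff
        (fps_nth (fps_X ^ l * (G ^ m - fps_X * fps_deriv G * G ^ (m - 1))) m) \<alpha>)"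
      using coeff_subst_fixed_point[OF assms(1,2), of "fps_X ^ l" \<alpha>] assms(3)
      by (simp add: subst_z_X_power[OF assms(1)] coeff_zw_def)
    also have "\<dots> = (\<Sum>m=1..2 * mdeg \<alpha>. \<Sum>k\<in>lagrange_indices l m. mfps_coeff (?t k) \<alpha>)"
      by (rule sum.cong, rule refl, subst fps_nth_X_power_lagrange) (use assms(3) in auto)
    also have "\<dots> = (\<Sum>k\<in>A \<alpha>. mfps_coeff (?t k) \<alpha>)"
      unfolding A_def
      by (rule sum.UNION_disjoint[symmetric]) (auto simp: finite_lagrange_indices, auto simp: lagrange_indices_def)
    also have "\<dots> = mfps_coeff (formal_sum ?t) \<alpha>"
      by (rule coeff_formal_sum[symmetric]) (use fin zero in auto)
    finally show "mfps_coeff (\<phi> ^ l) \<alpha> = mfps_coeff (formal_sum ?t) \<alpha>" .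
  qed
qed

end

theorem theorem3p5:
  fixes I :: "'i set"
    and G :: "('i, 'a::comm_ring_1) mfps fps"
  assumes "\<And>n. fps_nth G n \<in> mfps_over I"
    and "mfps_coeff (fps_nth G 0) 0 = 0"
    and "mfps_coeff (fps_nth G 1) 0 = 0"
  shows
    "(\<exists>!\<phi>. \<phi> \<in> mfps_over I \<and> mfps_coeff \<phi> 0 = 0 \<and> \<phi> = subst_z G \<phi>) \<and>
     (\<forall>l k. l \<ge> 1 \<longrightarrow> lagrange_c l k \<in> \<int>) \<and>
     (\<forall>\<phi>. \<phi> \<in> mfps_over I \<and> mfps_coeff \<phi> 0 = 0 \<and> \<phi> = subst_z G \<phi> \<longrightarrow>
        (\<forall>l\<ge>1.
           formal_summable (lagrange_term (fps_nth G) l) \<and>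
           \<phi> ^ l = formal_sum (lagrange_term (fps_nth G) l)) \<and>
        (\<forall>\<alpha>. Poly_Mapping.keys \<alpha> \<subseteq> I \<longrightarrow>
           mfps_coeff \<phi> \<alpha> =
             (\<Sum>m=1..2 * mdeg \<alpha>.
                coeff_zw (m - 1) \<alpha> (G ^ m - fps_X * fps_deriv G * G ^ (m - 1)))) \<and>
        (\<forall>H :: ('i, 'a) mfps fps. (\<forall>n. fps_nth H n \<in> mfps_over I) \<longrightarrow>
           (\<forall>\<alpha>. Poly_Mapping.keys \<alpha> \<subseteq> I \<longrightarrow>
              mfps_coeff (subst_z H \<phi>) \<alpha> =
                mfps_coeff (subst_z H 0) \<alpha> +
                (\<Sum>m=1..2 * mdeg \<alpha>.
                   coeff_zw m \<alpha> (H * (G ^ m - fps_X * fps_deriv G * G ^ (m - 1)))))))"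
proof (intro conjI allI impI)
  show "\<exists>!\<phi>. \<phi> \<in> mfps_over I \<and> mfps_coeff \<phi> 0 = 0 \<and> \<phi> = subst_z G \<phi>"
  proof (rule ex_ex1I)
    show "\<exists>\<phi>. \<phi> \<in> mfps_over I \<and> mfps_coeff \<phi> 0 = 0 \<and> \<phi> = subst_z G \<phi>"
      using fixed_point_exists[OF assms] by blast
  next
    fix \<phi> \<psi>
    assume "\<phi> \<in> mfps_over I \<and> mfps_coeff \<phi> 0 = 0 \<and> \<phi> = subst_z G \<phi>"
      and "\<psi> \<in> mfps_over I \<and> mfps_coeff \<psi> 0 = 0 \<and> \<psi> = subst_z G \<psi>"
    then have \<phi>: "mfps_coeff \<phi> 0 = 0" "\<phi> = subst_z G \<phi>"
      and \<psi>: "mfps_coeff \<psi> 0 = 0" "\<psi> = subst_z G \<psi>"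
      by blast+
    \<comment> \<open>the coefficient formula holds for every fixed point and does not mention it\<close>
    show "\<phi> = \<psi>"
      by (rule mfps_eqI)
        (simp only: coeff_fixed_point[OF assms(2,3) \<phi>] coeff_fixed_point[OF assms(2,3) \<psi>])
  qed
next
  fix l k assume "l \<ge> (1::nat)"
  then show "lagrange_c l k \<in> \<int>"
    by (simp only: lagrange_c_eq_head_excess Ints_of_int)
next
  fix \<phi> and l :: nat
  assume "\<phi> \<in> mfps_over I \<and> mfps_coeff \<phi> 0 = 0 \<and> \<phi> = subst_z G \<phi>" and "l \<ge> 1"
  then show "formal_summable (lagrange_term (fps_nth G) l)"
    and "\<phi> ^ l = formal_sum (lagrange_term (fps_nth G) l)"
    using power_fixed_point[OF assms(2,3)] by blast+
next
  fix \<phi> \<alpha>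
  assume "\<phi> \<in> mfps_over I \<and> mfps_coeff \<phi> 0 = 0 \<and> \<phi> = subst_z G \<phi>"
  then show "mfps_coeff \<phi> \<alpha> = (\<Sum>m=1..2 * mdeg \<alpha>.
      coeff_zw (m - 1) \<alpha> (G ^ m - fps_X * fps_deriv G * G ^ (m - 1)))"
    using coeff_fixed_point[OF assms(2,3)] by blast
next
  fix \<phi> \<alpha> and H :: "('i, 'a) mfps fps"
  assume "\<phi> \<in> mfps_over I \<and> mfps_coeff \<phi> 0 = 0 \<and> \<phi> = subst_z G \<phi>"
  then show "mfps_coeff (subst_z H \<phi>) \<alpha> = mfps_coeff (subst_z H 0) \<alpha> +
      (\<Sum>m=1..2 * mdeg \<alpha>. coeff_zw m \<alpha> (H * (G ^ m - fps_X * fps_deriv G * G ^ (m - 1))))"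
    using coeff_subst_fixed_point[OF assms(2,3)] by blast
qed

end
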